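(* Let $(P,\leq,{}',0,1)$ be a pseudo-orthomodular poset and define $M(x,y):=L(U(x,y'),y)$ and $R(x,y):=L(U(L(x,y),x'))$ for all $x,y\in P$. Then $\mathbf P=(P,\leq,{}',M,R,0,1)$ is an operator left residuated poset. Moreover, $\mathbf P$ satisfies divisibility (i.e. $M(R(x,y),x)=L(x,y)$ for all $x,y\in P$) if and only if for all $x,y\in P$ \[\bigcup_{z\in R(x,y)}L(U(z,x'),x)=L(U(R(x,y),x'),x).\]
   Context: For a poset $(P,\leq)$ and $A\subseteq P$ let $L(A)=\{x\in P\mid x\leq y\text{ for all }y\in A\}$ and $U(A)=\{x\in P\mid y\leq x\text{ for all }y\in A\}$; we write $L(a)$ for $L(\{a\})$, $L(a,b)$ for $L(\{a,b\})$, $L(A,a)$ for $L(A\cup\{a\})$, $L(A,B)$ for $L(A\cup B)$, etc., and similarly for $U$. A poset with complementation is $(P,\leq,{}',0,1)$ with $(P,\leq,0,1)$ a bounded poset and $'$ a unary operation such that $L(x,x')=\{0\}$, $U(x,x')=\{1\}$, $x\leq y$ implies $y'\leq x'$, and $(x')'=x$. A pseudo-orthomodular poset is a poset with complementation satisfying $L(U(L(x,y),y'),y)=L(x,y)$ for all $x,y$ (equivalently $U(L(U(x,y),y'),y)=U(x,y)$). An operator left residuated poset is a system $(P,\leq,{}',M,R,0,1)$ where $(P,\leq,0,1)$ is a bounded poset, $'$ is a unary operation, and $M,R:P^2\to 2^P$ satisfy for all $x,y,z$: (1) $M(x,1)=M(1,x)=L(x)$; (2) $R(x,y)=P$ iff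 $x\leq y$; (3) $M(x,y)\subseteq L(z)$ iff $L(x)\subseteq R(y,z)$; (4) $R(x,0)=L(x')$. For $A,B\subseteq P$, $M(A,B):=\bigcup_{(x,y)\in A\times B}M(x,y)$ and $R(A,B):=\bigcup_{(x,y)\in A\times B}R(x,y)$ (elements identified with singletons); divisibility is the identity $M(R(x,y),x)=L(x,y)$. *)

theory Defs
  imports Main
begin

text \<open>
  The carrier of a bounded poset is a type of class \<open>order_bot\<close> and \<open>order_top\<close>:
  the set \<open>P\<close> is \<open>UNIV\<close>, and \<open>0\<close>, \<open>1\<close> are \<open>bot\<close>, \<open>top\<close>.
  In the comma notation for cones, \<open>L(A, b)\<close> is \<open>L(A \<union> {b})\<close>.
\<close>

definition lower_cone :: "'a::order set \<Rightarrow> 'a set" where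
  "lower_cone A = {x. \<forall>y\<in>A. x \<le> y}"

definition upper_cone :: "'a::order set \<Rightarrow> 'a set" where
  "upper_cone A = {x. \<forall>y\<in>A. y \<le> x}"

locale complemented_poset =
  fixes compl :: "'a::{order_bot,order_top} \<Rightarrow> 'a"
  assumes lower_cone_compl: "lower_cone {x, compl x} = {bot}"
    and upper_cone_compl: "upper_cone {x, compl x} = {top}"
    and compl_antitone: "x \<le> y \<Longrightarrow> compl y \<le> compl x"
    and compl_involution: "compl (compl x) = x"

locale pseudo_orthomodular_poset = complemented_poset +
  assumes pseudo_orthomodular:
    "lower_cone (upper_cone (lower_cone {x, y} \<union> {compl y}) \<union> {y}) = lower_cone {x, y}"

locale operator_left_residuated_poset =
  fixes compl :: "'a::{order_bot,order_top} \<Rightarrow> 'a"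
    and M R :: "'a \<Rightarrow> 'a \<Rightarrow> 'a set"
  assumes M_top_right: "M x top = lower_cone {x}"
    and M_top_left: "M top x = lower_cone {x}"
    and R_eq_UNIV_iff: "R x y = UNIV \<longleftrightarrow> x \<le> y"
    and left_adjointness: "M x y \<subseteq> lower_cone {z} \<longleftrightarrow> lower_cone {x} \<subseteq> R y z"
    and R_bot: "R x bot = lower_cone {compl x}"

definition set_lift :: "('a \<Rightarrow> 'a \<Rightarrow> 'a set) \<Rightarrow> 'a set \<Rightarrow> 'a set \<Rightarrow> 'a set" where
  "set_lift F A B = (\<Union>(x, y)\<in>A \<times> B. F x y)"

definition divisibility ::
    "('a::order \<Rightarrow> 'a \<Rightarrow> 'a set) \<Rightarrow> ('a \<Rightarrow> 'a \<Rightarrow> 'a set) \<Rightarrow> bool" where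
  "divisibility M R \<longleftrightarrow> (\<forall>x y. set_lift M (R x y) {x} = lower_cone {x, y})"

end

theory Submission
  imports Defs
begin

text \<open>
  Complementation turns the pseudo-orthomodular law into its dual, and the two laws give the two
  directions of adjointness. Since \<open>U(L(U(A))) = U(A)\<close>, the pseudo-orthomodular law evaluates
  \<open>L(U(R(x,y),x'),x)\<close> to \<open>L(x,y)\<close>, so the displayed identity is divisibility with its right-hand
  side rewritten.
\<close>

lemma mem_lower_cone: "x \<in> lower_cone A \<longleftrightarrow> (\<forall>y\<in>A. x \<le> y)"
  by (simp add: lower_cone_def)

lemma mem_upper_cone: "x \<in> upper_cone A \<longleftrightarrow> (\<forall>y\<in>A. y \<le> x)"
  by (simp add: upper_cone_def)

lemma lower_cone_antimono: "A \<subseteq> B \<Longrightarrow> lower_cone B \<subseteq> lower_cone A"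
  by (auto simp: lower_cone_def)

lemma upper_cone_antimono: "A \<subseteq> B \<Longrightarrow> upper_cone B \<subseteq> upper_cone A"
  by (auto simp: upper_cone_def)

lemma lower_cone_upper_cone_singleton: "lower_cone (upper_cone {a}) = lower_cone {a}"
  by (auto simp: lower_cone_def upper_cone_def intro: order_trans)

lemma subset_lower_cone_upper_cone: "A \<subseteq> lower_cone (upper_cone A)"
  by (auto simp: lower_cone_def upper_cone_def)

lemma upper_cone_lower_cone_upper_cone: "upper_cone (lower_cone (upper_cone A)) = upper_cone A"
  by (auto simp: lower_cone_def upper_cone_def)

context complemented_poset
begin

lemma compl_le_iff: "compl x \<le> y \<longleftrightarrow> compl y \<le> x"
  using compl_antitone compl_involution by metis

lemma le_compl_iff: "x \<le> compl y \<longleftrightarrow> y \<le> compl x"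
  using compl_antitone compl_involution by metis

text \<open>The element \<open>compl top\<close> lies below both \<open>top\<close> and itself, and
  \<open>bot\<close> is the only common lower bound of that pair.\<close>

lemma compl_top: "compl top = bot"
  using lower_cone_compl[of top] by (auto simp: lower_cone_def)

lemma compl_mem_lower_cone_iff: "compl x \<in> lower_cone A \<longleftrightarrow> x \<in> upper_cone (compl ` A)"
  by (simp add: mem_lower_cone mem_upper_cone compl_le_iff)

lemma compl_mem_upper_cone_iff: "compl x \<in> upper_cone A \<longleftrightarrow> x \<in> lower_cone (compl ` A)"
  by (simp add: mem_lower_cone mem_upper_cone le_compl_iff)

text \<open>An antitone involution is an anti-automorphism of the order, so it exchanges lower and
  upper cones. This rule and its companion for \<open>upper_cone\<close> carry out the
  dualisation.\<close>

lemma compl_image_lower_cone: "compl ` lower_cone A = upper_cone (compl ` A)"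
proof (rule set_eqI)
  fix x
  have "x \<in> compl ` lower_cone A \<longleftrightarrow> compl x \<in> lower_cone A"
    using compl_involution by (metis image_iff)
  then show "x \<in> compl ` lower_cone A \<longleftrightarrow> x \<in> upper_cone (compl ` A)"
    by (simp add: compl_mem_lower_cone_iff)
qed

lemma compl_image_upper_cone: "compl ` upper_cone A = lower_cone (compl ` A)"
proof (rule set_eqI)
  fix x
  have "x \<in> compl ` upper_cone A \<longleftrightarrow> compl x \<in> upper_cone A"
    using compl_involution by (metis image_iff)
  then show "x \<in> compl ` upper_cone A \<longleftrightarrow> x \<in> lower_cone (compl ` A)"
    by (simp add: compl_mem_upper_cone_iff)
qed

end

context pseudo_orthomodular_poset
begin

lemma pseudo_orthomodular_dual:
  "upper_cone (lower_cone (upper_cone {x, y} \<union> {compl y}) \<union> {y}) = upper_cone {x, y}"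
proof -
  \<comment> \<open>The law is taken at the complements of \<open>x\<close> and \<open>y\<close>.
    Pushing \<open>compl\<close> inward through the cones then flips every cone and cancels the
    complements in pairs.\<close>
  have "compl ` lower_cone (upper_cone (lower_cone {compl x, compl y} \<union> {compl (compl y)}) \<union> {compl y})
      = compl ` lower_cone {compl x, compl y}"
    by (simp only: pseudo_orthomodular)
  then show ?thesis
    by (simp only: compl_image_lower_cone compl_image_upper_cone image_Un image_insert image_empty
        compl_involution)
qed

lemma lower_cone_upper_cone_residual:
  "lower_cone (upper_cone (lower_cone {x, y} \<union> {compl x}) \<union> {x}) = lower_cone {x, y}"
  using pseudo_orthomodular[of y x] by (simp add: insert_commute)

lemma residual_eq_UNIV_iff:
  "lower_cone (upper_cone (lower_cone {x, y} \<union> {compl x})) = UNIV \<longleftrightarrow> x \<le> y"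
proof
  assume "lower_cone (upper_cone (lower_cone {x, y} \<union> {compl x})) = UNIV"
  \<comment> \<open>If the residual is everything, it contains \<open>x\<close> itself.\<close>
  then have "x \<in> lower_cone (upper_cone (lower_cone {x, y} \<union> {compl x}) \<union> {x})"
    by (auto simp: lower_cone_def)
  then show "x \<le> y"
    unfolding lower_cone_upper_cone_residual by (simp add: mem_lower_cone)
next
  assume "x \<le> y"
  \<comment> \<open>Here \<open>x\<close> belongs to L(x,y), so the generating set contains
    \<open>x\<close> and its complement, whose only common upper bound is
    \<open>top\<close>.\<close>
  then have "{x, compl x} \<subseteq> lower_cone {x, y} \<union> {compl x}"
    by (auto simp: lower_cone_def)
  then have "upper_cone (lower_cone {x, y} \<union> {compl x}) \<subseteq> {top}"
    using upper_cone_antimono upper_cone_compl by metis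
  then show "lower_cone (upper_cone (lower_cone {x, y} \<union> {compl x})) = UNIV"
    by (auto simp: lower_cone_def)
qed

lemma adjointness:
  "lower_cone (upper_cone {x, compl y} \<union> {y}) \<subseteq> lower_cone {z} \<longleftrightarrow>
    lower_cone {x} \<subseteq> lower_cone (upper_cone (lower_cone {y, z} \<union> {compl y}))"
    (is "?M \<subseteq> _ \<longleftrightarrow> _ \<subseteq> lower_cone ?U")
proof
  assume "?M \<subseteq> lower_cone {z}"
  \<comment> \<open>By construction \<open>?M\<close> lies below \<open>y\<close>, so being below
    \<open>z\<close> puts it inside L(y,z).\<close>
  then have "?M \<union> {compl y} \<subseteq> lower_cone {y, z} \<union> {compl y}"
    by (auto simp: lower_cone_def)
  then have "?U \<subseteq> upper_cone (?M \<union> {compl y})"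
    by (rule upper_cone_antimono)
  \<comment> \<open>The dual law is used with \<open>compl y\<close> in place of \<open>y\<close>,
    so that the complement it adjoins inside the lower cone is \<open>y\<close>.\<close>
  also have "\<dots> = upper_cone {x, compl y}"
    using pseudo_orthomodular_dual[of x "compl y"] by (simp only: compl_involution)
  finally show "lower_cone {x} \<subseteq> lower_cone ?U"
    by (auto simp: lower_cone_def upper_cone_def intro: order_trans)
next
  assume "lower_cone {x} \<subseteq> lower_cone ?U"
  then have "x \<in> lower_cone ?U"
    by (auto simp: mem_lower_cone)
  \<comment> \<open>Every element of \<open>?U\<close> is above \<open>compl y\<close> by definition
    and above \<open>x\<close> by the assumption.\<close>
  then have "?U \<union> {y} \<subseteq> upper_cone {x, compl y} \<union> {y}"
    by (auto simp: lower_cone_def upper_cone_def)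
  then have "?M \<subseteq> lower_cone (?U \<union> {y})"
    by (rule lower_cone_antimono)
  also have "\<dots> = lower_cone {y, z}"
    by (rule lower_cone_upper_cone_residual)
  also have "\<dots> \<subseteq> lower_cone {z}"
    by (rule lower_cone_antimono) simp
  finally show "?M \<subseteq> lower_cone {z}" .
qed

lemma lower_cone_upper_cone_of_residual:
  "lower_cone (upper_cone (lower_cone (upper_cone (lower_cone {x, y} \<union> {compl x})) \<union> {compl x}) \<union> {x})
    = lower_cone {x, y}"
proof -
  let ?A = "lower_cone {x, y} \<union> {compl x}"
  \<comment> \<open>Adjoining \<open>compl x\<close> changes nothing, because the closure L(U(A))
    contains A and \<open>compl x\<close> is in A.\<close>
  have "lower_cone (upper_cone ?A) \<union> {compl x} = lower_cone (upper_cone ?A)"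
    using subset_lower_cone_upper_cone[of ?A] by blast
  then show ?thesis
    by (simp only: upper_cone_lower_cone_upper_cone lower_cone_upper_cone_residual)
qed

lemma operator_left_residuated:
  "operator_left_residuated_poset compl
    (\<lambda>x y. lower_cone (upper_cone {x, compl y} \<union> {y}))
    (\<lambda>x y. lower_cone (upper_cone (lower_cone {x, y} \<union> {compl x})))"
proof
  fix x y z
  \<comment> \<open>Both extra elements are vacuous: \<open>compl top\<close> is \<open>bot\<close>
    inside the upper cone, and \<open>top\<close> bounds everything in the lower cone.\<close>
  have "lower_cone (upper_cone {x, compl top} \<union> {top}) = lower_cone (upper_cone {x})"
    by (auto simp: compl_top lower_cone_def upper_cone_def)
  then show "lower_cone (upper_cone {x, compl top} \<union> {top}) = lower_cone {x}"
    by (simp only: lower_cone_upper_cone_singleton)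
  show "lower_cone (upper_cone {top, compl x} \<union> {x}) = lower_cone {x}"
    by (auto simp: lower_cone_def upper_cone_def top_unique)
  show "lower_cone (upper_cone (lower_cone {x, y} \<union> {compl x})) = UNIV \<longleftrightarrow> x \<le> y"
    by (rule residual_eq_UNIV_iff)
  show "lower_cone (upper_cone {x, compl y} \<union> {y}) \<subseteq> lower_cone {z} \<longleftrightarrow>
      lower_cone {x} \<subseteq> lower_cone (upper_cone (lower_cone {y, z} \<union> {compl y}))"
    by (rule adjointness)
  \<comment> \<open>The cone L(x,0) is just {0}, which puts no condition on upper bounds.\<close>
  have "upper_cone (lower_cone {x, bot} \<union> {compl x}) = upper_cone {compl x}"
    by (auto simp: lower_cone_def upper_cone_def bot_unique)
  then show "lower_cone (upper_cone (lower_cone {x, bot} \<union> {compl x})) = lower_cone {compl x}"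
    by (simp only: lower_cone_upper_cone_singleton)
qed

end

theorem theorem5:
  fixes compl :: "'a::{order_bot,order_top} \<Rightarrow> 'a"
    and M R :: "'a \<Rightarrow> 'a \<Rightarrow> 'a set"
  assumes "pseudo_orthomodular_poset compl"
    and "\<And>x y. M x y = lower_cone (upper_cone {x, compl y} \<union> {y})"
    and "\<And>x y. R x y = lower_cone (upper_cone (lower_cone {x, y} \<union> {compl x}))"
  shows "operator_left_residuated_poset compl M R \<and>
    (divisibility M R \<longleftrightarrow>
      (\<forall>x y. (\<Union>z\<in>R x y. lower_cone (upper_cone {z, compl x} \<union> {x})) =
        lower_cone (upper_cone (R x y \<union> {compl x}) \<union> {x})))"
proof -
  interpret pseudo_orthomodular_poset compl by fact
  have M: "M = (\<lambda>x y. lower_cone (upper_cone {x, compl y} \<union> {y}))"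
    using assms(2) by blast
  have R: "R = (\<lambda>x y. lower_cone (upper_cone (lower_cone {x, y} \<union> {compl x})))"
    using assms(3) by blast
  have "operator_left_residuated_poset compl M R"
    unfolding M R by (rule operator_left_residuated)
  \<comment> \<open>With \<open>x\<close> as the second argument of \<open>M\<close>, the lifted
    product is literally the union in the displayed identity.\<close>
  moreover have "set_lift M (R x y) {x} = (\<Union>z\<in>R x y. lower_cone (upper_cone {z, compl x} \<union> {x}))"
    for x y
    by (auto simp: set_lift_def assms(2))
  moreover have "lower_cone (upper_cone (R x y \<union> {compl x}) \<union> {x}) = lower_cone {x, y}" for x y
    unfolding R by (rule lower_cone_upper_cone_of_residual)
  ultimately show ?thesis
    by (simp only: divisibility_def simp_thms)
qed

end
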